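(* Let $\mathbb{F}$ be a field of characteristic two. For any nilpotent Lie algebra $\mathfrak{g}$ of Vergne type over $\mathbb{F}$ with $\dim\mathfrak{g}\ge 5$, there exists a Lie algebra $\mathfrak{h}$ of Vergne type over $\mathbb{F}$ which is not isomorphic to $\mathfrak{g}$ and has the same Betti numbers as $\mathfrak{g}$, i.e. $\dim H^k(\mathfrak{h},\mathbb{F})=\dim H^k(\mathfrak{g},\mathbb{F})$ for all $k$.
   Context: $\mathbb{F}$ is a field of characteristic two, and cohomology is Lie algebra (Chevalley–Eilenberg) cohomology with trivial coefficients. The $k$-th Betti number of a finite-dimensional Lie algebra $\mathfrak{g}$ over $\mathbb{F}$ is $\dim_{\mathbb{F}} H^k(\mathfrak{g},\mathbb{F})$. An $n$-dimensional nilpotent Lie algebra $\mathfrak{g}$ over $\mathbb{F}$ is filiform if there is $x\in\mathfrak{g}$ with $\mathrm{ad}(x)^{n-2}\neq 0$. An $n$-dimensional filiform Lie algebra $\mathfrak{g}$ over $\mathbb{F}$ is of Vergne type if it has a basis $e_1,\dots,e_n$ (called a Vergne basis) such that $[e_1,e_i]=e_{i+1}$ for all $2\le i\le n-1$ and $[e_i,e_j]=c_{i,j}e_{i+j}$ with some $c_{i,j}\in\mathbb{F}$ for all $i,j\ge 2$ with $i+j\le n$, all other brackets of basis elements (up to skew-symmetry) being zero. *)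

theory Defs
  imports
    "HOL-Library.Function_Algebras"
    "HOL-Library.Set_Algebras"
    "Jordan_Normal_Form.VS_Connect"
begin

section \<open>Lie algebras of Vergne type\<close>

locale lie_algebra = vector_space scale
  for scale :: "'f::field \<Rightarrow> 'v::ab_group_add \<Rightarrow> 'v" +
  fixes bracket :: "'v \<Rightarrow> 'v \<Rightarrow> 'v"
  assumes bracket_add_left: "bracket (x + y) z = bracket x z + bracket y z"
    and bracket_add_right: "bracket x (y + z) = bracket x y + bracket x z"
    and bracket_scale_left: "bracket (scale a x) y = scale a (bracket x y)"
    and bracket_scale_right: "bracket x (scale a y) = scale a (bracket x y)"
    and bracket_self: "bracket x x = 0"
    and jacobi: "bracket x (bracket y z) + bracket y (bracket z x) + bracket z (bracket x y) = 0"
begin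

fun lower_central :: "nat \<Rightarrow> 'v set" where
  "lower_central 0 = UNIV"
| "lower_central (Suc k) = span {bracket x y | x y. y \<in> lower_central k}"

definition nilpotent :: bool where
  "nilpotent \<longleftrightarrow> (\<exists>k. lower_central k = {0})"

text \<open>The dimension function of \<^locale>\<open>vector_space\<close> is \<open>0\<close> on infinite-dimensional spaces,
  so finite-dimensionality is required separately.\<close>

definition filiform :: bool where
  "filiform \<longleftrightarrow> (\<exists>S. finite S \<and> span S = UNIV) \<and> nilpotent \<and>
     (\<exists>x. (bracket x ^^ (dim UNIV - 2)) \<noteq> (\<lambda>_. 0))"

text \<open>Only the values \<open>e 1, \<dots>, e (dim UNIV)\<close> matter. The brackets not listed are determined by
  antisymmetry.\<close>

definition vergne_basis :: "(nat \<Rightarrow> 'v) \<Rightarrow> bool" where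
  "vergne_basis e \<longleftrightarrow> (let n = dim (UNIV :: 'v set) in
     inj_on e {1..n} \<and> independent (e ` {1..n}) \<and> span (e ` {1..n}) = UNIV \<and>
     (\<forall>i. 2 \<le> i \<and> i < n \<longrightarrow> bracket (e 1) (e i) = e (i + 1)) \<and>
     bracket (e 1) (e n) = 0 \<and>
     (\<exists>c :: nat \<Rightarrow> nat \<Rightarrow> 'f. \<forall>i j. 2 \<le> i \<and> 2 \<le> j \<and> i + j \<le> n \<longrightarrow>
        bracket (e i) (e j) = scale (c i j) (e (i + j))) \<and>
     (\<forall>i j. 2 \<le> i \<and> i \<le> n \<and> 2 \<le> j \<and> j \<le> n \<and> n < i + j \<longrightarrow> bracket (e i) (e j) = 0))"

definition vergne_type :: bool where
  "vergne_type \<longleftrightarrow> filiform \<and> (\<exists>e. vergne_basis e)"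

end

definition lie_isomorphic ::
  "('f::field \<Rightarrow> 'v::ab_group_add \<Rightarrow> 'v) \<Rightarrow> ('v \<Rightarrow> 'v \<Rightarrow> 'v) \<Rightarrow>
   ('f \<Rightarrow> 'w::ab_group_add \<Rightarrow> 'w) \<Rightarrow> ('w \<Rightarrow> 'w \<Rightarrow> 'w) \<Rightarrow> bool" where
  "lie_isomorphic scale bracket scale' bracket' \<longleftrightarrow>
     (\<exists>\<phi>. Vector_Spaces.linear scale scale' \<phi> \<and> bij \<phi> \<and>
        (\<forall>x y. \<phi> (bracket x y) = bracket' (\<phi> x) (\<phi> y)))"

section \<open>Chevalley--Eilenberg cohomology with trivial coefficients\<close>

text \<open>The quotient space of a subspace \<open>Z\<close> by a subspace \<open>B\<close>, with cosets of \<open>B\<close> as elements. In the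
  scalar multiplication, adding \<open>B\<close> again makes \<open>0 \<cdot> (z + B)\<close> equal to \<open>B\<close> rather than \<open>{0}\<close>.\<close>

definition quotient_space ::
  "('f::field \<Rightarrow> 'w::ab_group_add \<Rightarrow> 'w) \<Rightarrow> 'w set \<Rightarrow> 'w set \<Rightarrow> ('f, 'w set) module" where
  "quotient_space scl Z B =
     \<lparr>carrier = (\<lambda>z. z +o B) ` Z, mult = undefined, one = undefined,
      zero = B, add = (+), smult = (\<lambda>a X. scl a ` X + B)\<rparr>"

context lie_algebra
begin

text \<open>A \<open>k\<close>-cochain is an alternating \<open>k\<close>-linear form, that is, an element of the dual of the
  \<open>k\<close>-th exterior power. Its arguments are given as a list of length \<open>k\<close>; on lists of any other
  length it is \<open>0\<close> by convention. Alternating means vanishing on repeated arguments, which in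
  characteristic two is stronger than skew-symmetry.\<close>

definition cochains :: "nat \<Rightarrow> ('v list \<Rightarrow> 'f) set" where
  "cochains k = {f. (\<forall>xs. length xs \<noteq> k \<longrightarrow> f xs = 0) \<and>
     (\<forall>xs i. length xs = k \<and> i < k \<longrightarrow> Vector_Spaces.linear scale (*) (\<lambda>x. f (xs[i := x]))) \<and>
     (\<forall>xs i j. length xs = k \<and> i < j \<and> j < k \<and> xs ! i = xs ! j \<longrightarrow> f xs = 0)}"

text \<open>\<open>nths xs (- {i, j})\<close> is \<open>xs\<close> with the entries at positions \<open>i\<close> and \<open>j\<close> removed.\<close>

definition differential :: "('v list \<Rightarrow> 'f) \<Rightarrow> 'v list \<Rightarrow> 'f" where
  "differential f xs = (\<Sum>j<length xs. \<Sum>i<j.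
     (- 1) ^ (i + j) * f (bracket (xs ! i) (xs ! j) # nths xs (- {i, j})))"

definition cocycles :: "nat \<Rightarrow> ('v list \<Rightarrow> 'f) set" where
  "cocycles k = {f \<in> cochains k. differential f = 0}"

definition coboundaries :: "nat \<Rightarrow> ('v list \<Rightarrow> 'f) set" where
  "coboundaries k = (case k of 0 \<Rightarrow> {0} | Suc m \<Rightarrow> differential ` cochains m)"

definition cohomology :: "nat \<Rightarrow> ('f, ('v list \<Rightarrow> 'f) set) module" where
  "cohomology k = quotient_space (\<lambda>a f xs. a * f xs) (cocycles k) (coboundaries k)"

definition betti :: "nat \<Rightarrow> nat" where
  "betti k = vectorspace.dim class_ring (cohomology k)"

end

end

theory Submission
  imports Defs
begin

text \<open>Let \<open>D = ad e\<^sub>1\<close> and let \<open>a\<close> be a multiple of the form dual to \<open>e\<^sub>2\<close>. In characteristic two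
  \<open>D\<^sup>2\<close> is again a derivation, so \<open>[x, y]' = [x, y] + a(x) D\<^sup>2 y + a(y) D\<^sup>2 x\<close> is a Lie bracket of
  Vergne type; its effect is to add a scalar to all the constants \<open>c\<^bsub>2,j\<^esub>\<close>. The new differential is
  \<open>d' = d + a \<and> L\<^sub>D\<^sup>2\<close>, because the Lie derivative along \<open>D\<^sup>2\<close> is the square of the one along \<open>D\<close>.
  The involution \<open>\<Phi> = 1 + a \<and> (\<iota> \<circ> L\<^sub>D)\<close>, where \<open>\<iota>\<close> is contraction with \<open>e\<^sub>1\<close>, satisfies
  \<open>\<Phi> d' = d \<Phi>\<close> by Cartan's formula \<open>d \<iota> + \<iota> d = L\<^sub>D\<close>, so all Betti numbers agree. The scalar is
  chosen such that exactly one of the two algebras has \<open>c\<^bsub>2,3\<^esub> = 0\<close>; this condition is invariant under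
  isomorphism, since it means that some \<open>x \<notin> [g, g]\<close> satisfies \<open>[x, [g, g]] \<subseteq> \<gamma>\<close>, where \<open>\<gamma>\<close> is the
  lower central term spanned by \<open>e\<^sub>6, \<dots>, e\<^sub>n\<close>.\<close>

section \<open>Operators on alternating forms in characteristic two\<close>

text \<open>The Lie derivative along \<open>d\<close> up to sign, which is immaterial in
  characteristic two. Recursion on the argument list suits induction.\<close>

fun lie_derivative :: "('v \<Rightarrow> 'v) \<Rightarrow> ('v list \<Rightarrow> 'f::comm_monoid_add) \<Rightarrow> 'v list \<Rightarrow> 'f" where
  "lie_derivative d f [] = 0"
| "lie_derivative d f (x # xs) = f (d x # xs) + lie_derivative d (\<lambda>ys. f (x # ys)) xs"

text \<open>The exterior product of a one-form with \<open>f\<close>; the alternating signs are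
  dropped because the characteristic will be two.\<close>

fun wedge :: "('v \<Rightarrow> 'f::comm_semiring_0) \<Rightarrow> ('v list \<Rightarrow> 'f) \<Rightarrow> 'v list \<Rightarrow> 'f" where
  "wedge a f [] = 0"
| "wedge a f (x # xs) = a x * f xs + wedge a (\<lambda>ys. f (x # ys)) xs"

lemma lie_derivative_add:
  "lie_derivative d (\<lambda>xs. f xs + g xs) xs = lie_derivative d f xs + lie_derivative d g xs"
  by (induction xs arbitrary: f g) (simp_all add: algebra_simps)

lemma lie_derivative_mult:
  "lie_derivative d (\<lambda>xs. c * f xs) xs = (c :: 'f::comm_semiring_0) * lie_derivative d f xs"
  by (induction xs arbitrary: f) (simp_all add: algebra_simps)

lemma lie_derivative_zero [simp]: "lie_derivative d (\<lambda>xs. 0) xs = 0"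
  by (induction xs) simp_all

lemma wedge_add: "wedge a (\<lambda>xs. f xs + g xs) xs = wedge a f xs + wedge a g xs"
  by (induction xs arbitrary: f g) (simp_all add: algebra_simps)

lemma wedge_mult: "wedge a (\<lambda>xs. c * f xs) xs = c * wedge a f xs"
  by (induction xs arbitrary: f) (simp_all add: algebra_simps)

lemma wedge_zero [simp]: "wedge a (\<lambda>xs. 0) xs = 0"
  by (induction xs) simp_all

lemma lie_derivative_length:
  "(\<And>ys. length ys \<noteq> k \<Longrightarrow> f ys = 0) \<Longrightarrow> length xs \<noteq> k \<Longrightarrow> lie_derivative d f xs = 0"
proof (induction xs arbitrary: f k)
  case (Cons x xs)
  show ?case
  proof (cases k)
    case 0
    then show ?thesis using Cons.prems(1) by simp
  next
    case (Suc m)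
    have "lie_derivative d (\<lambda>ys. f (x # ys)) xs = 0"
      by (rule Cons.IH[of m]) (use Cons.prems Suc in auto)
    then show ?thesis using Cons.prems by simp
  qed
qed simp

text \<open>Writing \<open>Suc (length ys)\<close> covers \<open>k = 0\<close> as well, where the
  premise says that \<open>f\<close> vanishes everywhere.\<close>

lemma wedge_length:
  "(\<And>ys. Suc (length ys) \<noteq> k \<Longrightarrow> f ys = 0) \<Longrightarrow> length xs \<noteq> k \<Longrightarrow> wedge a f xs = 0"
proof (induction xs arbitrary: f k)
  case (Cons x xs)
  show ?case
  proof (cases k)
    case 0
    then show ?thesis using Cons.prems(1) by simp
  next
    case (Suc m)
    have "wedge a (\<lambda>ys. f (x # ys)) xs = 0"
      by (rule Cons.IH[of m]) (use Cons.prems Suc in auto)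
    then show ?thesis using Cons.prems Suc by simp
  qed
qed simp

section \<open>Alternating multilinear forms over a field of characteristic two\<close>

locale char2_vector_space = vector_space scale
  for scale :: "'f::field \<Rightarrow> 'v::ab_group_add \<Rightarrow> 'v" +
  assumes char2: "CHAR('f) = 2"
begin

lemma two_eq_zero: "(2::'f) = 0"
  using of_nat_CHAR[where 'a='f] char2 by simp

lemma add_self [simp]: "(a::'f) + a = 0"
  using two_eq_zero by (metis mult_2 mult_zero_left)

lemma add_self_left [simp]: "(a::'f) + (a + b) = b"
  by (simp add: add.assoc[symmetric])

lemma minus_eq [simp]: "- (a::'f) = a"
  by (metis add_self minus_unique)

lemma vec_add_self [simp]: "(x::'v) + x = 0"
  by (metis add_self scale_left_distrib scale_one scale_zero_left)

lemma vec_add_self_left [simp]: "(x::'v) + (x + y) = y"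
  by (simp add: add.assoc[symmetric])

text \<open>Unlike for cochains, the length of the argument list is not restricted, so the identities below
  can be proved by induction on the list: fixing the first argument of an alternating form yields an
  alternating form.\<close>

definition alternating :: "('v list \<Rightarrow> 'f) \<Rightarrow> bool" where
  "alternating f \<longleftrightarrow>
     (\<forall>us x y zs. f (us @ (x + y) # zs) = f (us @ x # zs) + f (us @ y # zs)) \<and>
     (\<forall>us c x zs. f (us @ scale c x # zs) = c * f (us @ x # zs)) \<and>
     (\<forall>us x zs. f (us @ x # x # zs) = 0)"

lemma alternatingD:
  assumes "alternating f"
  shows "f (us @ (x + y) # zs) = f (us @ x # zs) + f (us @ y # zs)"
    and "f (us @ scale c x # zs) = c * f (us @ x # zs)"
    and "f (us @ x # x # zs) = 0"
    and "f ((x + y) # zs) = f (x # zs) + f (y # zs)"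
    and "f (scale c x # zs) = c * f (x # zs)"
    and "f (x # x # zs) = 0"
  using assms unfolding alternating_def by (blast, blast, blast, metis append_Nil, metis append_Nil, metis append_Nil)

lemma alternating_Cons: "alternating f \<Longrightarrow> alternating (\<lambda>ys. f (x # ys))"
  unfolding alternating_def by (metis append_Cons)

lemma alternating_add: "alternating f \<Longrightarrow> alternating g \<Longrightarrow> alternating (\<lambda>xs. f xs + g xs)"
  unfolding alternating_def by (simp add: algebra_simps)

lemma alternating_mult: "alternating f \<Longrightarrow> alternating (\<lambda>xs. c * f xs)"
  unfolding alternating_def by (simp add: algebra_simps)

text \<open>Polarization: the form vanishes on the repeated argument \<open>x + y\<close>, and
  expanding leaves only the two mixed terms.\<close>

lemma alternating_swap:
  assumes "alternating f"
  shows "f (us @ x # y # zs) = f (us @ y # x # zs)"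
proof -
  note D = alternatingD[OF assms]
  have "0 = f (us @ (x + y) # (x + y) # zs)"
    by (simp add: D)
  also have "\<dots> = f (us @ x # (x + y) # zs) + f (us @ y # (x + y) # zs)"
    by (rule D)
  also have "f (us @ x # (x + y) # zs) = f (us @ x # y # zs)"
    using D(1)[of "us @ [x]"] D(3) by simp
  also have "f (us @ y # (x + y) # zs) = f (us @ y # x # zs)"
    using D(1)[of "us @ [y]"] D(3) by simp
  finally show ?thesis
    by (metis add_self_left add.right_neutral)
qed

lemma alternating_move:
  assumes "alternating f"
  shows "f (us @ x # vs @ zs) = f (us @ vs @ x # zs)"
proof (induction vs arbitrary: us)
  case (Cons v vs)
  show ?case
    using Cons[of "us @ [v]"] alternating_swap[OF assms, of us x v "vs @ zs"] by simp
qed simp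

lemma alternatingI:
  assumes "\<And>us x y zs. f (us @ (x + y) # zs) = f (us @ x # zs) + f (us @ y # zs)"
    and "\<And>us c x zs. f (us @ scale c x # zs) = c * f (us @ x # zs)"
    and "\<And>us x zs. f (us @ x # x # zs) = 0"
  shows "alternating f"
  using assms unfolding alternating_def by blast

lemma alternating_lie_derivative:
  assumes f: "alternating f"
    and d: "\<And>x y. d (x + y) = d x + d y" "\<And>c x. d (scale c x) = scale c (d x)"
  shows "alternating (lie_derivative d f)"
proof (rule alternatingI)
  fix us x y zs c
  show "lie_derivative d f (us @ (x + y) # zs) =
      lie_derivative d f (us @ x # zs) + lie_derivative d f (us @ y # zs)"
    using f
  proof (induction us arbitrary: f)
    case Nil
    note D = alternatingD[OF Nil]
    show ?case by (simp add: D d lie_derivative_add algebra_simps)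
  next
    case (Cons u us)
    note D = alternatingD[OF Cons.prems]
    show ?case using Cons.IH[OF alternating_Cons[OF Cons.prems]] D(1)[of "d u # us"]
      by (simp add: algebra_simps)
  qed
  show "lie_derivative d f (us @ scale c x # zs) = c * lie_derivative d f (us @ x # zs)"
    using f
  proof (induction us arbitrary: f)
    case Nil
    note D = alternatingD[OF Nil]
    show ?case by (simp add: D d lie_derivative_mult algebra_simps)
  next
    case (Cons u us)
    note D = alternatingD[OF Cons.prems]
    show ?case using Cons.IH[OF alternating_Cons[OF Cons.prems]] D(2)[of "d u # us"]
      by (simp add: algebra_simps)
  qed
  show "lie_derivative d f (us @ x # x # zs) = 0"
    using f
  proof (induction us arbitrary: f)
    case Nil
    note D = alternatingD[OF Nil]
    \<comment> \<open>The terms with \<open>d\<close> on the first or on the second copy of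
      \<open>x\<close> agree by a swap and cancel; all others still contain both copies.\<close>
    show ?case using alternating_swap[OF Nil, of "[]" "d x" x zs] by (simp add: D algebra_simps)
  next
    case (Cons u us)
    note D = alternatingD[OF Cons.prems]
    show ?case using Cons.IH[OF alternating_Cons[OF Cons.prems]] D(3)[of "d u # us"]
      by (simp add: algebra_simps)
  qed
qed

lemma alternating_wedge:
  assumes f: "alternating f"
    and a: "\<And>x y. a (x + y) = a x + a y" "\<And>c x. a (scale c x) = c * a x"
  shows "alternating (wedge a f)"
proof (rule alternatingI)
  fix us x y zs c
  show "wedge a f (us @ (x + y) # zs) = wedge a f (us @ x # zs) + wedge a f (us @ y # zs)"
    using f
  proof (induction us arbitrary: f)
    case Nil
    note D = alternatingD[OF Nil]
    show ?case by (simp add: D a wedge_add algebra_simps)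
  next
    case (Cons u us)
    note D = alternatingD[OF Cons.prems]
    show ?case using Cons.IH[OF alternating_Cons[OF Cons.prems]] D(1)[of us]
      by (simp add: algebra_simps)
  qed
  show "wedge a f (us @ scale c x # zs) = c * wedge a f (us @ x # zs)"
    using f
  proof (induction us arbitrary: f)
    case Nil
    note D = alternatingD[OF Nil]
    show ?case by (simp add: D a wedge_mult algebra_simps)
  next
    case (Cons u us)
    note D = alternatingD[OF Cons.prems]
    show ?case using Cons.IH[OF alternating_Cons[OF Cons.prems]] D(2)[of us]
      by (simp add: algebra_simps)
  qed
  show "wedge a f (us @ x # x # zs) = 0"
    using f
  proof (induction us arbitrary: f)
    case Nil
    note D = alternatingD[OF Nil]
    \<comment> \<open>Each copy of \<open>x\<close> contributes \<open>a x * f (x # zs)\<close>, and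
      the two contributions cancel.\<close>
    show ?case by (simp add: D algebra_simps)
  next
    case (Cons u us)
    note D = alternatingD[OF Cons.prems]
    show ?case using Cons.IH[OF alternating_Cons[OF Cons.prems]] D(3)[of us]
      by (simp add: algebra_simps)
  qed
qed

section \<open>Relations between Lie derivatives and wedge products\<close>

lemma lie_derivative_commutator:
  assumes "alternating f"
  shows "lie_derivative d (lie_derivative d' f) xs + lie_derivative d' (lie_derivative d f) xs =
    lie_derivative (\<lambda>x. d (d' x) + d' (d x)) f xs"
  using assms
proof (induction xs arbitrary: f)
  case (Cons x xs)
  note D = alternatingD[OF Cons.prems]
  show ?case
    using Cons.IH[OF alternating_Cons[OF Cons.prems], of x, symmetric]
    by (simp add: lie_derivative_add D algebra_simps)
qed simp

text \<open>The square also produces the terms with \<open>d\<close> in two different positions, but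
  each of these occurs twice.\<close>

lemma lie_derivative_square:
  "lie_derivative (\<lambda>x. d (d x)) f xs = lie_derivative d (lie_derivative d f) xs"
  for f :: "'v list \<Rightarrow> 'f"
  by (induction xs arbitrary: f) (simp_all add: lie_derivative_add algebra_simps)

text \<open>Leibniz rule, in which the summands with \<open>d\<close> on the argument of
  \<open>a\<close> vanish by assumption.\<close>

lemma lie_derivative_wedge:
  fixes f :: "'v list \<Rightarrow> 'f"
  assumes "\<And>x. a (d x) = 0"
  shows "lie_derivative d (wedge a f) xs = wedge a (lie_derivative d f) xs"
  by (induction xs arbitrary: f)
    (simp_all add: assms lie_derivative_add lie_derivative_mult wedge_add add_ac)

lemma wedge_wedge: "wedge a (wedge a f) xs = 0" for f :: "'v list \<Rightarrow> 'f"
  by (induction xs arbitrary: f) (simp_all add: wedge_add wedge_mult)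

text \<open>A map of rank one acts on forms as contraction with \<open>v\<close> followed by the
  wedge product with \<open>a\<close>. Such a map is one summand of the deformed bracket with its
  first argument fixed.\<close>

lemma lie_derivative_rank_one:
  assumes "alternating f"
  shows "lie_derivative (\<lambda>x. scale (a x) v) f xs = wedge a (\<lambda>ys. f (v # ys)) xs"
  using assms
proof (induction xs arbitrary: f)
  case (Cons x xs)
  note D = alternatingD[OF Cons.prems]
  show ?case
    using Cons.IH[OF alternating_Cons[OF Cons.prems], of x] alternating_swap[OF Cons.prems, of "[]" v x]
    by (simp add: D)
qed simp

lemma lie_derivative_add_map:
  assumes "alternating f"
  shows "lie_derivative (\<lambda>x. d x + d' x) f xs = lie_derivative d f xs + lie_derivative d' f xs"
  using assms
proof (induction xs arbitrary: f)
  case (Cons x xs)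
  note D = alternatingD[OF Cons.prems]
  show ?case
    using Cons.IH[OF alternating_Cons[OF Cons.prems], of x]
    by (simp add: D algebra_simps)
qed simp

lemma lie_derivative_scale_map:
  assumes "alternating f"
  shows "lie_derivative (\<lambda>x. scale c (d x)) f xs = c * lie_derivative d f xs"
  using assms
proof (induction xs arbitrary: f)
  case (Cons x xs)
  note D = alternatingD[OF Cons.prems]
  show ?case
    using Cons.IH[OF alternating_Cons[OF Cons.prems], of x]
    by (simp add: D algebra_simps)
qed simp

text \<open>Puts the changed argument in front, as \<open>differential\<close> does with its
  brackets; swaps cost no sign.\<close>

lemma lie_derivative_conv_sum:
  assumes "alternating f"
  shows "lie_derivative d f xs = (\<Sum>j<length xs. f (d (xs ! j) # nths xs (- {j})))"
  using assms
proof (induction xs arbitrary: f)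
  case (Cons x xs)
  have 1: "nths (x # xs) (- {0}) = xs"
  proof -
    have "{j. Suc j \<in> - {0}} = UNIV" by auto
    then show ?thesis by (simp add: nths_Cons nths_all)
  qed
  have 2: "nths (x # xs) (- {Suc j}) = x # nths xs (- {j})" for j
  proof -
    have "{i. Suc i \<in> - {Suc j}} = - {j}" by auto
    then show ?thesis by (simp add: nths_Cons)
  qed
  have sw: "f (x # y # zs) = f (y # x # zs)" for y zs
    using alternating_swap[OF Cons.prems, of "[]" x y] by simp
  show ?case
    using Cons.IH[OF alternating_Cons[OF Cons.prems], of x]
    by (simp only: lie_derivative.simps list.size sum.lessThan_Suc_shift add_0_right add_Suc_right
      nth_Cons_0 nth_Cons_Suc 1 2 sw)
qed simp

end

lemma (in lie_algebra) bracket_zero [simp]: "bracket 0 x = 0" "bracket x 0 = 0"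
  using bracket_scale_left[of 0 0 x] bracket_scale_right[of x 0 0] by simp_all

lemma (in lie_algebra) bracket_skew: "bracket y x = - bracket x y"
proof -
  have "bracket (x + y) (x + y) = bracket x x + bracket x y + (bracket y x + bracket y y)"
    by (simp only: bracket_add_left bracket_add_right add_ac)
  then have "bracket x y + bracket y x = 0"
    by (simp add: bracket_self)
  then show ?thesis by (simp add: add_eq_0_iff)
qed

section \<open>The Chevalley-Eilenberg differential in characteristic two\<close>

locale char2_lie_algebra = lie_algebra scale bracket + char2_vector_space scale
  for scale :: "'f::field \<Rightarrow> 'v::ab_group_add \<Rightarrow> 'v" and bracket
begin

lemma differential_Nil [simp]: "differential f [] = 0"
  by (simp add: differential_def)

text \<open>Cartan's formula: the pairs of positions containing the first one give the Lie
  derivative along \<open>bracket x\<close>, the remaining pairs the differential of the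
  contraction. This recursion drives the inductions below.\<close>

lemma differential_Cons:
  assumes "alternating f"
  shows "differential f (x # xs) =
    lie_derivative (bracket x) f xs + differential (\<lambda>ys. f (x # ys)) xs"
proof -
  have 1: "nths (x # xs) (- {0, Suc j}) = nths xs (- {j})" for j
  proof -
    have "{i. Suc i \<in> - {0, Suc j}} = - {j}" by auto
    then show ?thesis by (simp add: nths_Cons)
  qed
  have 2: "nths (x # xs) (- {Suc i, Suc j}) = x # nths xs (- {i, j})" for i j
  proof -
    have "{k. Suc k \<in> - {Suc i, Suc j}} = - {i, j}" by auto
    then show ?thesis by (simp add: nths_Cons)
  qed
  have sw: "f (y # x # zs) = f (x # y # zs)" for y zs
    using alternating_swap[OF assms, of "[]" x y] by simp
  show ?thesis
    unfolding differential_def lie_derivative_conv_sum[OF assms]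
    by (simp add: sum.lessThan_Suc_shift 1 2 sw sum.distrib del: sum.lessThan_Suc)
qed

lemma differential_add:
  "differential (\<lambda>xs. f xs + g xs) xs = differential f xs + differential g xs"
  by (simp add: differential_def sum.distrib algebra_simps)

lemma differential_mult: "differential (\<lambda>xs. c * f xs) xs = c * differential f xs"
  by (simp add: differential_def sum_distrib_left algebra_simps)

lemma differential_zero: "differential (\<lambda>xs. 0) xs = 0"
  by (simp add: differential_def)

lemma bracket_commute: "bracket x y = bracket y x"
  using bracket_skew[of y x] by (metis minus_unique vec_add_self)

lemma bracket_derivation:
  "bracket x (bracket y z) = bracket (bracket x y) z + bracket y (bracket x z)"
proof -
  have "bracket x (bracket y z) + (bracket (bracket x y) z + bracket y (bracket x z)) = 0"
    using jacobi[of x y z] bracket_commute by (metis add.assoc add.commute)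
  then show ?thesis by (metis vec_add_self_left add.right_neutral)
qed

text \<open>By \<open>differential_Cons\<close> the induction step comes down to the commutator of
  \<open>d\<close> and \<open>bracket x\<close>, which the derivation property identifies with
  \<open>bracket (d x)\<close>.\<close>

lemma differential_lie_derivative:
  assumes "alternating f"
    and "\<And>x y. d (x + y) = d x + d y" "\<And>c x. d (scale c x) = scale c (d x)"
    and der: "\<And>x y. d (bracket x y) = bracket (d x) y + bracket x (d y)"
  shows "differential (lie_derivative d f) xs = lie_derivative d (differential f) xs"
  using assms(1)
proof (induction xs arbitrary: f)
  case (Cons x xs)
  have "differential (lie_derivative d f) (x # xs) =
      lie_derivative (bracket x) (lie_derivative d f) xs + differential (\<lambda>ys. f (d x # ys)) xs
      + lie_derivative d (differential (\<lambda>ys. f (x # ys))) xs"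
    using alternating_lie_derivative[OF Cons.prems, of d] assms(2,3)
      Cons.IH[OF alternating_Cons[OF Cons.prems], of x]
    by (simp add: differential_Cons differential_add add_ac)
  moreover have "lie_derivative (bracket x) (lie_derivative d f) xs =
      lie_derivative d (lie_derivative (bracket x) f) xs + lie_derivative (bracket (d x)) f xs"
    using lie_derivative_commutator[OF Cons.prems, of d "bracket x" xs]
    by (simp add: der add.assoc) (metis add.commute add_self_left)
  ultimately show ?case
    using Cons.prems by (simp add: differential_Cons lie_derivative_add add_ac)
qed simp

text \<open>A one-form vanishing on brackets is closed, so the Leibniz rule for the differential
  leaves one term.\<close>

lemma differential_wedge:
  assumes "alternating f"
    and "\<And>x y. a (x + y) = a x + a y" "\<And>c x. a (scale c x) = c * a x"
    and "\<And>x y. a (bracket x y) = 0"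
  shows "differential (wedge a f) xs = wedge a (differential f) xs"
  using assms(1)
proof (induction xs arbitrary: f)
  case (Cons x xs)
  have "alternating (wedge a f)"
    using alternating_wedge[OF Cons.prems, of a] assms(2,3) by blast
  then have "differential (wedge a f) (x # xs) =
      wedge a (lie_derivative (bracket x) f) xs + (a x * differential f xs
      + wedge a (differential (\<lambda>ys. f (x # ys))) xs)"
    using Cons.IH[OF alternating_Cons[OF Cons.prems], of x] assms(4)
    by (simp add: differential_Cons differential_add differential_mult lie_derivative_wedge)
  then show ?case
    using Cons.prems by (simp add: differential_Cons wedge_add add_ac)
qed simp

text \<open>Links the cochains to the length-free notion. Cochains must vanish on any two equal
  entries, \<open>alternating\<close> asks this for adjacent ones only;
  \<open>alternating_move\<close> bridges the gap.\<close>

lemma cochains_eq: "cochains k = {f. alternating f \<and> (\<forall>xs. length xs \<noteq> k \<longrightarrow> f xs = 0)}"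
proof (intro Set.set_eqI iffI)
  fix f
  assume f: "f \<in> cochains k"
  then have z: "f xs = 0" if "length xs \<noteq> k" for xs
    using that by (simp add: cochains_def)
  have lin: "Vector_Spaces.linear scale (*) (\<lambda>x. f (us @ x # zs))"
    if "length (us @ x # zs) = k" for us x zs
  proof -
    have "\<forall>xs i. length xs = k \<and> i < k \<longrightarrow> Vector_Spaces.linear scale (*) (\<lambda>x. f (xs[i := x]))"
      using f by (simp add: cochains_def)
    moreover have "length us < k" using that by simp
    ultimately have "Vector_Spaces.linear scale (*) (\<lambda>y. f ((us @ x # zs)[length us := y]))"
      using that by blast
    then show ?thesis by simp
  qed
  have "alternating f"
  proof (rule alternatingI)
    fix us x y zs c
    show "f (us @ (x + y) # zs) = f (us @ x # zs) + f (us @ y # zs)"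
      using lin[of us x zs] z by (cases "length (us @ x # zs) = k") (simp_all add: Vector_Spaces.linear_iff)
    show "f (us @ scale c x # zs) = c * f (us @ x # zs)"
      using lin[of us x zs] z by (cases "length (us @ x # zs) = k") (simp_all add: Vector_Spaces.linear_iff)
    show "f (us @ x # x # zs) = 0"
    proof (cases "length (us @ x # x # zs) = k")
      case True
      have "\<forall>xs i j. length xs = k \<and> i < j \<and> j < k \<and> xs ! i = xs ! j \<longrightarrow> f xs = 0"
        using f by (simp add: cochains_def)
      moreover have "(us @ x # x # zs) ! length us = (us @ x # x # zs) ! Suc (length us)"
        by (simp add: nth_append)
      moreover have "length us < Suc (length us)" "Suc (length us) < k"
        using True by auto
      ultimately show ?thesis
        using True by blast
    qed (use z in auto)
  qed
  then show "f \<in> {f. alternating f \<and> (\<forall>xs. length xs \<noteq> k \<longrightarrow> f xs = 0)}"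
    using z by blast
next
  fix f
  assume "f \<in> {f. alternating f \<and> (\<forall>xs. length xs \<noteq> k \<longrightarrow> f xs = 0)}"
  then have f: "alternating f" and z: "\<And>xs. length xs \<noteq> k \<Longrightarrow> f xs = 0" by auto
  interpret s: vector_space "(*) :: 'f \<Rightarrow> 'f \<Rightarrow> 'f"
    by unfold_locales (simp_all add: algebra_simps)
  have "Vector_Spaces.linear scale (*) (\<lambda>x. f (xs[i := x]))" if "i < length xs" for xs i
    unfolding upd_conv_take_nth_drop[OF that] Vector_Spaces.linear_iff
    by (intro conjI allI vector_space_axioms s.vector_space_axioms) (simp_all add: alternatingD[OF f])
  moreover have "f xs = 0" if "i < j" "j < length xs" "xs ! i = xs ! j" for xs i j
  proof -
    define us x vs zs where "us = take i xs" and "x = xs ! i"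
      and "vs = take (j - Suc i) (drop (Suc i) xs)" and "zs = drop (Suc j) xs"
    have "drop (Suc i) xs = vs @ x # zs"
      using id_take_nth_drop[of "j - Suc i" "drop (Suc i) xs"] that
      by (simp add: vs_def zs_def x_def)
    then have "xs = us @ x # vs @ x # zs"
      using id_take_nth_drop[of i xs] that by (simp add: us_def x_def)
    then show ?thesis
      using alternating_move[OF f, of us x vs "x # zs"] alternatingD(3)[OF f, of "us @ vs" x zs] by simp
  qed
  ultimately show "f \<in> cochains k"
    unfolding cochains_def using z by auto
qed

end

section \<open>Deformation by the square of an inner derivation\<close>

text \<open>\<open>a_bracket\<close> makes \<open>a\<close> a one-cocycle. \<open>a_e\<close> lets
  contraction with \<open>e\<close> commute with the wedge product by \<open>a\<close>, which is
  used to show that \<open>twist\<close> is an involution.\<close>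

locale char2_deformation = char2_lie_algebra scale bracket
  for scale :: "'f::field \<Rightarrow> 'v::ab_group_add \<Rightarrow> 'v" and bracket +
  fixes a :: "'v \<Rightarrow> 'f" and e :: 'v
  assumes a_add: "a (x + y) = a x + a y"
    and a_scale: "a (scale c x) = c * a x"
    and a_bracket: "a (bracket x y) = 0"
    and a_e: "a e = 0"
begin

definition ad_square :: "'v \<Rightarrow> 'v" where
  "ad_square x = bracket e (bracket e x)"

definition deformed :: "'v \<Rightarrow> 'v \<Rightarrow> 'v" where
  "deformed x y = bracket x y + scale (a x) (ad_square y) + scale (a y) (ad_square x)"

lemma ad_square_linear:
  "ad_square (x + y) = ad_square x + ad_square y"
  "ad_square (scale c x) = scale c (ad_square x)"
  by (simp_all add: ad_square_def bracket_add_right bracket_scale_right)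

text \<open>Applying the derivation \<open>bracket e\<close> twice, the mixed term
  \<open>bracket (bracket e x) (bracket e y)\<close> occurs twice and cancels.\<close>

lemma ad_square_bracket:
  "ad_square (bracket x y) = bracket (ad_square x) y + bracket x (ad_square y)"
proof -
  have "ad_square (bracket x y) = bracket e (bracket (bracket e x) y) + bracket e (bracket x (bracket e y))"
    unfolding ad_square_def bracket_derivation[of e x y] bracket_add_right ..
  then show ?thesis
    unfolding ad_square_def bracket_derivation[of e "bracket e x" y] bracket_derivation[of e x "bracket e y"]
    by (simp add: add_ac)
qed

lemma a_deformed: "a (deformed x y) = 0"
  by (simp add: deformed_def ad_square_def a_add a_scale a_bracket)

text \<open>The expansion is grouped by degree in \<open>a\<close>, in preparation for the Jacobi
  identity.\<close>

lemma deformed_deformed: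
  "deformed x (deformed y z) = bracket x (bracket y z) +
    (scale (a y) (bracket x (ad_square z)) +
     scale (a z) (bracket x (ad_square y)) +
     scale (a x) (bracket z (ad_square y)) +
     scale (a x) (bracket y (ad_square z))) +
    (scale (a x * a y) (ad_square (ad_square z)) +
     scale (a x * a z) (ad_square (ad_square y)))"
proof -
  have "bracket x (deformed y z) = bracket x (bracket y z) +
      (scale (a y) (bracket x (ad_square z)) + scale (a z) (bracket x (ad_square y)))"
    by (simp only: deformed_def bracket_add_right bracket_scale_right add.assoc)
  moreover have "ad_square (deformed y z) =
      (bracket z (ad_square y) + bracket y (ad_square z)) +
      (scale (a y) (ad_square (ad_square z)) + scale (a z) (ad_square (ad_square y)))"
    by (simp only: deformed_def ad_square_linear ad_square_bracket bracket_commute[of "ad_square y" z] add.assoc)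
  ultimately show ?thesis
    by (simp only: deformed_def[of x] a_deformed scale_right_distrib scale_scale scale_zero_left
        add_0_left add_0_right add_ac)
qed

sublocale deformed: char2_lie_algebra scale deformed
proof
  fix x y z c
  show "deformed (x + y) z = deformed x z + deformed y z"
    by (simp add: deformed_def bracket_add_left ad_square_linear a_add scale_left_distrib scale_right_distrib add_ac)
  show "deformed x (y + z) = deformed x y + deformed x z"
    by (simp add: deformed_def bracket_add_right ad_square_linear a_add scale_left_distrib scale_right_distrib add_ac)
  show "deformed (scale c x) y = scale c (deformed x y)"
    by (simp add: deformed_def bracket_scale_left ad_square_linear a_scale scale_right_distrib mult.commute)
  show "deformed x (scale c y) = scale c (deformed x y)"
    by (simp add: deformed_def bracket_scale_right ad_square_linear a_scale scale_right_distrib mult.commute)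
  show "deformed x x = 0"
    by (simp add: deformed_def bracket_self add.assoc)
  \<comment> \<open>The terms free of \<open>a\<close> cancel by the old Jacobi identity; every term
    of degree one or two in \<open>a\<close> occurs twice in the cyclic sum.\<close>
  show "deformed x (deformed y z) + deformed y (deformed z x) + deformed z (deformed x y) = 0"
    using jacobi[of x y z]
    unfolding deformed_deformed
    by (simp add: add_ac mult.commute[of "a y" "a x"] mult.commute[of "a z" "a x"] mult.commute[of "a z" "a y"])
qed

text \<open>\<open>deformed x\<close> is the sum of \<open>bracket x\<close>, a multiple of
  \<open>ad_square\<close> and a map of rank one. Under Cartan's formula the last two supply the
  terms of the wedge product in which \<open>a\<close> or \<open>ad_square\<close> meets the first
  argument.\<close>

lemma differential_deformed:
  assumes "alternating f"
  shows "deformed.differential f xs =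
    differential f xs + wedge a (lie_derivative ad_square f) xs"
  using assms
proof (induction xs arbitrary: f)
  case (Cons x xs)
  have "lie_derivative (deformed x) f xs = lie_derivative (bracket x) f xs
      + a x * lie_derivative ad_square f xs + wedge a (\<lambda>ys. f (ad_square x # ys)) xs"
    unfolding deformed_def
    by (simp add: Cons.prems lie_derivative_add_map lie_derivative_scale_map lie_derivative_rank_one)
  then show ?case
    using Cons.IH[OF alternating_Cons[OF Cons.prems], of x] Cons.prems
    by (simp add: differential_Cons deformed.differential_Cons wedge_add add_ac)
qed simp

text \<open>In terms of a basis of the dual space, the form dual to \<open>e\<close> is replaced by its sum with the
  operator \<open>a \<and> L\<^sub>e\<close>.\<close>

definition twist :: "('v list \<Rightarrow> 'f) \<Rightarrow> 'v list \<Rightarrow> 'f" where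
  "twist f xs = f xs + wedge a (\<lambda>ys. lie_derivative (bracket e) f (e # ys)) xs"

text \<open>\<open>twist\<close> is the identity plus an operator \<open>N\<close>. Wedging with
  \<open>a\<close> commutes with the Lie derivative and the contraction, so \<open>N\<close> applied
  twice wedges with \<open>a\<close> twice and vanishes; the two copies of \<open>N\<close> itself
  cancel.\<close>

lemma twist_twist: "twist (twist f) = f"
proof
  fix xs
  have L: "lie_derivative (bracket e) (wedge a g) ys = wedge a (lie_derivative (bracket e) g) ys"
    for g :: "'v list \<Rightarrow> 'f" and ys
    by (simp add: lie_derivative_wedge a_bracket)
  show "twist (twist f) xs = f xs"
    unfolding twist_def[abs_def]
    by (simp only: lie_derivative_add L wedge_add wedge.simps a_e wedge_wedge mult_zero_left
        add.assoc add_self add_0_left add_0_right)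
qed

lemma twist_add: "twist (f + g) = twist f + twist g"
  by (rule ext)
    (simp only: twist_def plus_fun_def lie_derivative_add wedge_add add_ac)

lemma twist_mult: "twist (\<lambda>xs. c * f xs) = (\<lambda>xs. c * twist f xs)"
  by (rule ext)
    (simp only: twist_def lie_derivative_mult wedge_mult distrib_left)

lemma twist_zero: "twist 0 = 0"
  using twist_mult[of 0 "0"] by (simp add: zero_fun_def)

lemma twist_differential:
  assumes f: "alternating f"
  shows "twist (deformed.differential f) = differential (twist f)"
proof
  fix xs
  let ?L = "lie_derivative (bracket e)"
  have Lf: "alternating (?L f)"
    by (rule alternating_lie_derivative[OF f bracket_add_right bracket_scale_right])
  have sq: "lie_derivative ad_square f = ?L (?L f)"
    by (rule ext) (simp add: ad_square_def[abs_def] lie_derivative_square)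
  have d': "deformed.differential f = (\<lambda>ys. differential f ys + wedge a (?L (?L f)) ys)"
    by (rule ext) (simp only: differential_deformed[OF f] sq)
  have L: "?L (wedge a g) ys = wedge a (?L g) ys" for g :: "'v list \<Rightarrow> 'f" and ys
    by (simp add: lie_derivative_wedge a_bracket)
  have dL: "?L (differential f) ys = differential (?L f) ys" for ys
    by (rule differential_lie_derivative[OF f bracket_add_right bracket_scale_right bracket_derivation, symmetric])
  \<comment> \<open>From the summand that already carries \<open>a\<close>, the correction term of
    \<open>twist\<close> gives zero, as \<open>a\<close> is wedged twice. On the other summand,
    Cartan's formula for \<open>?L f\<close> yields a second copy of \<open>?L (?L f)\<close>, which
    cancels the first.\<close>
  have "twist (deformed.differential f) xs = differential f xs + wedge a (?L (?L f)) xs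
      + wedge a (\<lambda>ys. ?L (?L f) ys + differential (\<lambda>ys. ?L f (e # ys)) ys) xs"
    unfolding twist_def d'
    by (simp only: lie_derivative_add L dL wedge_add wedge.simps a_e wedge_wedge differential_Cons[OF Lf]) simp
  also have "\<dots> = differential f xs + wedge a (differential (\<lambda>ys. ?L f (e # ys))) xs"
    by (simp only: wedge_add add.assoc add_self_left)
  also have "\<dots> = differential (twist f) xs"
    unfolding twist_def[abs_def] differential_add
    using differential_wedge[OF alternating_Cons[OF Lf] a_add a_scale a_bracket] by simp
  finally show "twist (deformed.differential f) xs = differential (twist f) xs" .
qed

lemma alternating_twist: "alternating f \<Longrightarrow> alternating (twist f)"
  unfolding twist_def[abs_def]
  by (intro alternating_add alternating_wedge alternating_Cons alternating_lie_derivative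
      a_add a_scale bracket_add_right bracket_scale_right)

lemma differential_twist:
  assumes "alternating f"
  shows "twist (differential f) = deformed.differential (twist f)"
  using twist_differential[OF alternating_twist[OF assms]] by (metis twist_twist)

text \<open>Contraction lowers the degree by one and the wedge product restores it.\<close>

lemma twist_cochains:
  assumes "f \<in> cochains k"
  shows "twist f \<in> cochains k"
proof -
  have f: "alternating f" and z: "\<And>xs. length xs \<noteq> k \<Longrightarrow> f xs = 0"
    using assms by (auto simp: cochains_eq)
  have "twist f xs = 0" if "length xs \<noteq> k" for xs
  proof -
    have "wedge a (\<lambda>ys. lie_derivative (bracket e) f (e # ys)) xs = 0"
      by (rule wedge_length[OF _ that], rule lie_derivative_length[of k f, OF z]) auto
    then show ?thesis using z that by (simp add: twist_def)
  qed
  then show ?thesis using alternating_twist[OF f] by (simp add: cochains_eq)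
qed

end

section \<open>Invariance of the Betti numbers\<close>

text \<open>Without a finite generating set the predicate minimized in \<open>dim\<close> is false
  everywhere, so all such spaces share one default value.\<close>

lemma (in vectorspace) dim_infinite: "\<not> fin_dim \<Longrightarrow> dim = (LEAST n. False)"
  unfolding dim_def fin_dim_def by (rule arg_cong[where f = Least]) auto

text \<open>The maps transfer finite-dimensionality both ways; in the infinite-dimensional case the
  two dimensions agree as the common default value.\<close>

lemma (in linear_map) dim_eq_of_inverse:
  assumes S: "linear_map K W V S"
    and ST: "\<And>x. x \<in> carrier V \<Longrightarrow> S (T x) = x"
    and TS: "\<And>y. y \<in> carrier W \<Longrightarrow> T (S y) = y"
  shows "vectorspace.dim K V = vectorspace.dim K W"
proof -
  interpret S: linear_map K W V S by (fact S)
  have surj: "T ` carrier V = carrier W"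
    using TS S.T_im T_im by (metis (no_types, lifting) image_iff image_subset_iff order_antisym subsetI)
  have surjS: "S ` carrier W = carrier V"
    using ST S.T_im T_im by (metis (no_types, lifting) image_iff image_subset_iff order_antisym subsetI)
  have inj: "inj_on T (carrier V)"
    using ST by (rule inj_on_inverseI)
  show ?thesis
  proof (cases "V.fin_dim")
    case True
    then show ?thesis by (rule dim_eq[OF _ inj surj])
  next
    case False
    then have "\<not> W.fin_dim"
      using S.surj_fin_dim[OF _ surjS] by blast
    then show ?thesis
      using False V.dim_infinite W.dim_infinite by simp
  qed
qed

section \<open>Cosets and maps induced on quotient spaces\<close>

context vector_space
begin

lemma coset_add:
  assumes "subspace B"
  shows "(x +o B) + (y +o B) = (x + y) +o B"
proof (intro Set.set_eqI iffI)
  fix z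
  assume "z \<in> (x +o B) + (y +o B)"
  then obtain b c where "b \<in> B" "c \<in> B" "z = (x + b) + (y + c)"
    by (auto simp: set_plus_def elt_set_plus_def)
  moreover from this have "b + c \<in> B" using subspace_add[OF assms] by blast
  moreover have "(x + b) + (y + c) = (x + y) + (b + c)" by (simp add: algebra_simps)
  ultimately show "z \<in> (x + y) +o B" unfolding elt_set_plus_def by blast
next
  fix z
  assume "z \<in> (x + y) +o B"
  then obtain b where b: "b \<in> B" "z = (x + y) + b"
    by (auto simp: elt_set_plus_def)
  then have "z = (x + b) + (y + 0)" by (simp add: algebra_simps)
  then show "z \<in> (x +o B) + (y +o B)"
    using b(1) subspace_0[OF assms] unfolding set_plus_def elt_set_plus_def by blast
qed

lemma coset_scale:
  assumes "subspace B"
  shows "scale c ` (x +o B) + B = scale c x +o B"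
proof (intro Set.set_eqI iffI)
  fix z
  assume "z \<in> scale c ` (x +o B) + B"
  then obtain b d where "b \<in> B" "d \<in> B" "z = scale c (x + b) + d"
    by (auto simp: set_plus_def elt_set_plus_def)
  moreover from this have "scale c b + d \<in> B"
    using subspace_add[OF assms] subspace_scale[OF assms] by blast
  moreover have "scale c (x + b) + d = scale c x + (scale c b + d)" by (simp add: scale_right_distrib add.assoc)
  ultimately show "z \<in> scale c x +o B" unfolding elt_set_plus_def by blast
next
  fix z
  assume "z \<in> scale c x +o B"
  then obtain b where b: "b \<in> B" "z = scale c (x + 0) + b"
    by (auto simp: elt_set_plus_def)
  then show "z \<in> scale c ` (x +o B) + B"
    using subspace_0[OF assms] unfolding set_plus_def elt_set_plus_def by blast
qed

text \<open>\<open>B \<subseteq> Z\<close> is not assumed: the cosets \<open>z + B\<close> with \<open>z \<in> Z\<close> still form the vector space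
  \<open>(Z + B) / B\<close>.\<close>

lemma vectorspace_quotient_space:
  assumes Z: "subspace Z" and B: "subspace B"
  shows "vectorspace class_ring (quotient_space scale Z B)"
proof -
  define V where "V = quotient_space scale Z B"
  have carrier: "carrier V = (\<lambda>z. z +o B) ` Z"
    and add: "\<And>x y. (x +o B) \<oplus>\<^bsub>V\<^esub> (y +o B) = (x + y) +o B"
    and smult: "\<And>c x. c \<odot>\<^bsub>V\<^esub> (x +o B) = scale c x +o B"
    and zero: "\<zero>\<^bsub>V\<^esub> = 0 +o B"
    by (simp_all add: V_def quotient_space_def coset_add[OF B] coset_scale[OF B])
  have "vectorspace class_ring V"
  proof (rule vs_criteria, goal_cases)
    case 1
    show ?case by (rule class_field.field_axioms)
  next
    case 2
    show ?case unfolding carrier zero by (rule imageI) (rule subspace_0[OF Z])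
  next
    case 3
    show ?case unfolding carrier by (auto simp: add intro!: imageI subspace_add[OF Z])
  next
    case 4
    show ?case unfolding carrier
    proof
      fix u assume "u \<in> (\<lambda>z. z +o B) ` Z"
      then obtain z where z: "z \<in> Z" "u = z +o B" by blast
      have "u \<oplus>\<^bsub>V\<^esub> (- z +o B) = \<zero>\<^bsub>V\<^esub>" unfolding z(2) add zero by simp
      moreover have "- z \<in> Z" using subspace_neg[OF Z z(1)] .
      ultimately show "\<exists>v\<in>(\<lambda>z. z +o B) ` Z. u \<oplus>\<^bsub>V\<^esub> v = \<zero>\<^bsub>V\<^esub>" by blast
    qed
  next
    case 5
    show ?case unfolding carrier by (auto simp: smult intro!: imageI subspace_scale[OF Z])
  qed (unfold carrier, auto simp: add add[of _ 0, simplified] smult zero class_ring_simps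
      scale_left_distrib scale_right_distrib add_ac)
  then show ?thesis unfolding V_def .
qed

text \<open>The induced map takes the image of a coset. That \<open>T\<close> maps \<open>B\<close>
  onto \<open>B'\<close>, not merely into it, makes this image a full coset of
  \<open>B'\<close>.\<close>

lemma linear_map_quotient_space:
  assumes "subspace Z" "subspace B" "subspace Z'" "subspace B'"
    and T: "\<And>x y. T (x + y) = T x + T y" "\<And>c x. T (scale c x) = scale c (T x)"
    and "T ` Z \<subseteq> Z'" "T ` B = B'"
  shows "linear_map class_ring (quotient_space scale Z B) (quotient_space scale Z' B') (image T)"
proof -
  have coset: "T ` (x +o B) = T x +o B'" for x
    using assms(8) T(1) by (auto simp: elt_set_plus_def image_iff) (metis T(1) imageI)
  have im: "T ` X \<in> carrier (quotient_space scale Z' B')"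
    if "X \<in> carrier (quotient_space scale Z B)" for X
    using that assms(7) by (auto simp: quotient_space_def coset)
  have "image T \<in> LinearCombinations.module_hom class_ring (quotient_space scale Z B) (quotient_space scale Z' B')"
    unfolding LinearCombinations.module_hom_def
  proof (intro CollectI conjI allI impI, goal_cases)
    case 1
    show ?case using im by blast
  next
    case (2 X Y)
    then obtain x y where "X = x +o B" "Y = y +o B" by (auto simp: quotient_space_def)
    then show ?case
      by (simp add: quotient_space_def coset coset_add[OF assms(2)] coset_add[OF assms(4)] T)
  next
    case (3 c X)
    then obtain x where "X = x +o B" by (auto simp: quotient_space_def)
    then show ?case
      by (simp add: quotient_space_def coset coset_scale[OF assms(2)] coset_scale[OF assms(4)] T)
  qed
  then show "linear_map class_ring (quotient_space scale Z B) (quotient_space scale Z' B') (image T)"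
    using vectorspace_quotient_space[OF assms(1,2)] vectorspace_quotient_space[OF assms(3,4)]
    by (simp add: linear_map_def mod_hom_def mod_hom_axioms_def vectorspace_def)
qed

lemma dim_quotient_space_eq:
  assumes "subspace Z" "subspace B" "subspace Z'" "subspace B'"
    and "\<And>x y. T (x + y) = T x + T y" "\<And>c x. T (scale c x) = scale c (T x)"
    and TT: "\<And>x. T (T x) = x"
    and "T ` Z \<subseteq> Z'" "T ` Z' \<subseteq> Z" "T ` B \<subseteq> B'" "T ` B' \<subseteq> B"
  shows "vectorspace.dim class_ring (quotient_space scale Z B) =
    vectorspace.dim class_ring (quotient_space scale Z' B')"
proof -
  \<comment> \<open>Since \<open>T\<close> is its own inverse, the two inclusions become the
    equalities that the induced maps require.\<close>
  have *: "T ` B = B'" "T ` B' = B"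
    using assms(10,11) TT by (auto simp: image_iff subset_iff) metis+
  note lin = linear_map_quotient_space[where T = T, OF _ _ _ _ assms(5,6)]
  show ?thesis
    by (rule linear_map.dim_eq_of_inverse[OF lin[OF assms(1-4,8) *(1)] lin[OF assms(3,4,1,2,9) *(2)]])
      (simp_all add: image_image TT)
qed

end

lemma vector_space_pointwise: "vector_space (\<lambda>(a::'f::field) (f :: 'x \<Rightarrow> 'f) xs. a * f xs)"
  by unfold_locales (auto simp: fun_eq_iff algebra_simps)

section \<open>Cochains, cocycles and coboundaries as subspaces\<close>

context char2_lie_algebra
begin

interpretation F: vector_space "\<lambda>(a::'f) (f :: 'v list \<Rightarrow> 'f) xs. a * f xs"
  by (rule vector_space_pointwise)

lemma subspace_cochains: "F.subspace (cochains k)"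
  unfolding F.subspace_def cochains_eq
  by (auto simp: alternating_add alternating_mult plus_fun_def zero_fun_def alternating_def algebra_simps)

lemma subspace_cocycles: "F.subspace (cocycles k)"
  using subspace_cochains[of k]
  unfolding F.subspace_def cocycles_def
  by (auto simp: fun_eq_iff differential_mult differential_add differential_zero plus_fun_def zero_fun_def)

lemma subspace_coboundaries: "F.subspace (coboundaries k)"
proof (cases k)
  case 0
  then show ?thesis by (simp add: coboundaries_def F.subspace_0)
next
  case (Suc m)
  have 1: "differential 0 = 0"
    by (simp add: fun_eq_iff zero_fun_def differential_zero)
  have 2: "differential f + differential g = differential (f + g)" for f g
    by (simp add: fun_eq_iff differential_add plus_fun_def)
  have 3: "(\<lambda>xs. c * differential f xs) = differential (\<lambda>xs. c * f xs)" for f c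
    by (simp add: fun_eq_iff differential_mult)
  have "F.subspace (differential ` cochains m)"
    unfolding F.subspace_def
  proof (intro conjI ballI allI)
    show "0 \<in> differential ` cochains m"
      using imageI[OF F.subspace_0[OF subspace_cochains[of m]], of differential] unfolding 1 .
  next
    fix f g assume "f \<in> differential ` cochains m" "g \<in> differential ` cochains m"
    then show "f + g \<in> differential ` cochains m"
      by (elim imageE, simp only: 2) (intro imageI F.subspace_add[OF subspace_cochains])
  next
    fix c f assume "f \<in> differential ` cochains m"
    then show "(\<lambda>xs. c * f xs) \<in> differential ` cochains m"
      by (elim imageE, simp only: 3) (intro imageI F.subspace_scale[OF subspace_cochains])
  qed
  then show ?thesis by (simp add: coboundaries_def Suc)
qed

end

context char2_deformation
begin

text \<open>The involution \<open>twist\<close> intertwines the two differentials, so it carries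
  cocycles to cocycles and coboundaries to coboundaries in both directions.\<close>

theorem betti_deformed: "deformed.betti k = betti k"
proof -
  interpret F: vector_space "\<lambda>(a::'f) (f :: 'v list \<Rightarrow> 'f) xs. a * f xs"
    by (rule vector_space_pointwise)
  show ?thesis
    unfolding betti_def deformed.betti_def cohomology_def deformed.cohomology_def
  proof (rule F.dim_quotient_space_eq[where T = twist])
    \<comment> \<open>Cochains do not involve the bracket, so both algebras share them.\<close>
    have alt: "alternating f" if "f \<in> cochains k" for f k
      using that by (simp add: cochains_eq)
    show "twist ` deformed.cocycles k \<subseteq> cocycles k"
    proof clarify
      fix f assume "f \<in> deformed.cocycles k"
      then have "f \<in> cochains k" "deformed.differential f = 0"
        by (simp_all add: deformed.cocycles_def)
      then show "twist f \<in> cocycles k"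
        using twist_differential[OF alt, of f k] by (simp add: cocycles_def twist_cochains twist_zero)
    qed
    show "twist ` cocycles k \<subseteq> deformed.cocycles k"
    proof clarify
      fix f assume "f \<in> cocycles k"
      then have "f \<in> cochains k" "differential f = 0"
        by (simp_all add: cocycles_def)
      then show "twist f \<in> deformed.cocycles k"
        using differential_twist[OF alt, of f k]
        by (simp add: deformed.cocycles_def twist_cochains twist_zero)
    qed
    show "twist ` deformed.coboundaries k \<subseteq> coboundaries k"
    proof (cases k)
      case (Suc m)
      then show ?thesis
        using twist_differential[OF alt] twist_cochains
        by (auto simp: coboundaries_def deformed.coboundaries_def)
    qed (simp add: coboundaries_def deformed.coboundaries_def twist_zero)
    show "twist ` coboundaries k \<subseteq> deformed.coboundaries k"
    proof (cases k)
      case (Suc m)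
      then show ?thesis
        using differential_twist[OF alt] twist_cochains
        by (auto simp: coboundaries_def deformed.coboundaries_def)
    qed (simp add: coboundaries_def deformed.coboundaries_def twist_zero)
  qed (simp_all add: subspace_cocycles deformed.subspace_cocycles subspace_coboundaries
        deformed.subspace_coboundaries twist_twist twist_add twist_mult)
qed

end

section \<open>Algebras of Vergne type\<close>

text \<open>Ensures that conditions phrased by the bracket and the lower central series are
  isomorphism invariants.\<close>

lemma lie_isomorphic_lower_central:
  assumes "lie_algebra scale bracket" "lie_algebra scale' bracket'"
    and lin: "Vector_Spaces.linear scale scale' \<phi>" and bij: "bij \<phi>"
    and hom: "\<And>x y. \<phi> (bracket x y) = bracket' (\<phi> x) (\<phi> y)"
  shows "\<phi> ` lie_algebra.lower_central scale bracket k = lie_algebra.lower_central scale' bracket' k"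
proof -
  interpret L: lie_algebra scale bracket by fact
  interpret L': lie_algebra scale' bracket' by fact
  interpret \<phi>: Vector_Spaces.linear scale scale' \<phi> by fact
  show ?thesis
  proof (induction k)
    case 0
    then show ?case using bij by (simp add: bij_is_surj)
  next
    case (Suc k)
    have "\<phi> ` {bracket x y | x y. y \<in> L.lower_central k} =
        {bracket' x y | x y. y \<in> L'.lower_central k}" (is "?A = ?B")
    proof
      show "?A \<subseteq> ?B"
        using Suc hom by blast
      show "?B \<subseteq> ?A"
      proof clarify
        fix x y assume "y \<in> L'.lower_central k"
        then obtain y' where "y' \<in> L.lower_central k" "y = \<phi> y'" using Suc by blast
        moreover obtain x' where "x = \<phi> x'" using bij by (metis bij_pointE)
        ultimately have "bracket' x y = \<phi> (bracket x' y')" "bracket x' y' \<in> {bracket x y | x y. y \<in> L.lower_central k}"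
          using hom by auto
        then show "bracket' x y \<in> ?A" by blast
      qed
    qed
    then show ?case
      unfolding L.lower_central.simps L'.lower_central.simps \<phi>.span_image[symmetric] by (rule arg_cong)
  qed
qed

lemma (in lie_algebra) bracket_span:
  assumes "x \<in> span A" "y \<in> span B" "\<And>a b. a \<in> A \<Longrightarrow> b \<in> B \<Longrightarrow> bracket a b \<in> span C"
  shows "bracket x y \<in> span C"
proof -
  have *: "bracket a y \<in> span C" if "a \<in> A" for a
    using assms(2)
  proof (induction rule: span_induct_alt)
    case base
    show ?case by (simp add: span_zero)
  next
    case (step c b z)
    then show ?case using assms(3)[OF that]
      by (simp add: bracket_add_right bracket_scale_right span_add span_scale)
  qed
  show ?thesis
    using assms(1)
  proof (induction rule: span_induct_alt)
    case base
    show ?case by (simp add: span_zero)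
  next
    case (step c b z)
    then show ?case using *
      by (simp add: bracket_add_left bracket_scale_left span_add span_scale)
  qed
qed

section \<open>Filtration and lower central series of an algebra with a Vergne basis\<close>

locale vergne_algebra = lie_algebra scale bracket
  for scale :: "'f::field \<Rightarrow> 'v::ab_group_add \<Rightarrow> 'v" and bracket +
  fixes e :: "nat \<Rightarrow> 'v" and n :: nat
  assumes vergne: "vergne_basis e"
    and n_def: "n = dim (UNIV :: 'v set)"
    and n_ge: "5 \<le> n"
begin

lemma basis:
  "inj_on e {1..n}" "independent (e ` {1..n})" "span (e ` {1..n}) = UNIV"
  using vergne by (simp_all add: vergne_basis_def n_def Let_def)

lemma bracket_e1: "2 \<le> i \<Longrightarrow> i < n \<Longrightarrow> bracket (e 1) (e i) = e (i + 1)"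
  and bracket_e1_last: "bracket (e 1) (e n) = 0"
  and bracket_e_eq_zero: "2 \<le> i \<Longrightarrow> i \<le> n \<Longrightarrow> 2 \<le> j \<Longrightarrow> j \<le> n \<Longrightarrow> n < i + j \<Longrightarrow> bracket (e i) (e j) = 0"
  using vergne by (simp_all add: vergne_basis_def n_def Let_def)

text \<open>\<open>vergne_basis\<close> only asserts that constants exist, hence the choice. For
  \<open>i\<close> and \<open>j\<close> at least 2 with \<open>i + j \<le> n\<close> they are
  determined by the basis, because \<open>e (i + j)\<close> is nonzero.\<close>

definition structure_constant :: "nat \<Rightarrow> nat \<Rightarrow> 'f" where
  "structure_constant = (SOME c. \<forall>i j. 2 \<le> i \<and> 2 \<le> j \<and> i + j \<le> n \<longrightarrow>
        bracket (e i) (e j) = scale (c i j) (e (i + j)))"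

lemma bracket_structure_constant:
  assumes "2 \<le> i" "2 \<le> j" "i + j \<le> n"
  shows "bracket (e i) (e j) = scale (structure_constant i j) (e (i + j))"
proof -
  have "\<exists>c. \<forall>i j. 2 \<le> i \<and> 2 \<le> j \<and> i + j \<le> n \<longrightarrow> bracket (e i) (e j) = scale (c i j) (e (i + j))"
    using vergne by (simp add: vergne_basis_def n_def Let_def)
  from someI_ex[OF this] show ?thesis
    using assms unfolding structure_constant_def by blast
qed

definition tail :: "nat \<Rightarrow> 'v set" where
  "tail k = span (e ` {k..n})"

lemma tail_mono: "k \<le> l \<Longrightarrow> tail l \<subseteq> tail k"
  unfolding tail_def by (intro span_mono image_mono) auto

lemma e_in_tail: "k \<le> i \<Longrightarrow> i \<le> n \<Longrightarrow> e i \<in> tail k"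
  unfolding tail_def by (intro span_base imageI) auto

text \<open>Brackets respect the grading by the index. The bound 3 matters only for
  \<open>i = j = 1\<close>, where the bracket is zero; it places all brackets in
  \<open>tail 3\<close>.\<close>

lemma bracket_basis:
  assumes "1 \<le> i" "i \<le> n" "1 \<le> j" "j \<le> n"
  shows "bracket (e i) (e j) \<in> tail (max 3 (i + j))"
proof -
  have zero: "0 \<in> tail k" for k by (simp add: tail_def span_zero)
  have e1: "bracket (e 1) (e j) \<in> tail (max 3 (1 + j))" if "1 \<le> j" "j \<le> n" for j
  proof -
    have "j = 1 \<or> 2 \<le> j \<and> j < n \<or> j = n"
      using that by linarith
    then consider "j = 1" | "2 \<le> j" "j < n" | "j = n"
      by blast
    then show ?thesis
    proof cases
      case 2
      then show ?thesis using e_in_tail[of "max 3 (1 + j)" "j + 1"] by (simp add: bracket_e1 del: One_nat_def)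
    qed (simp_all add: bracket_self bracket_e1_last zero del: One_nat_def)
  qed
  have "i = 1 \<or> j = 1 \<or> 2 \<le> i \<and> 2 \<le> j"
    using assms by linarith
  then consider "i = 1" | "j = 1" | "2 \<le> i" "2 \<le> j"
    by blast
  then show ?thesis
  proof cases
    case 1
    then show ?thesis using e1[of j] assms by simp
  next
    case 2
    then show ?thesis
      using e1[of i] assms bracket_skew[of "e i" "e 1"] by (simp add: tail_def span_neg add.commute)
  next
    case 3
    show ?thesis
    proof (cases "i + j \<le> n")
      case True
      then show ?thesis
        using 3 e_in_tail[of "max 3 (i + j)" "i + j"]
        by (simp add: bracket_structure_constant) (simp add: tail_def span_scale)
    next
      case False
      then show ?thesis using 3 assms by (simp add: bracket_e_eq_zero zero)
    qed
  qed
qed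

lemma bracket_tail:
  assumes "x \<in> tail k" "y \<in> tail l" "1 \<le> k" "1 \<le> l" "m \<le> max 3 (k + l)"
  shows "bracket x y \<in> tail m"
  unfolding tail_def
proof (rule bracket_span[OF assms(1,2)[unfolded tail_def]])
  fix a b assume "a \<in> e ` {k..n}" "b \<in> e ` {l..n}"
  then obtain i j where "a = e i" "b = e j" "k \<le> i" "i \<le> n" "l \<le> j" "j \<le> n" by auto
  then have "bracket a b \<in> tail (max 3 (i + j))" "m \<le> max 3 (i + j)"
    using bracket_basis assms(3-5) by auto
  then show "bracket a b \<in> span (e ` {m..n})"
    using tail_mono unfolding tail_def by blast
qed

lemma UNIV_tail: "x \<in> tail 1"
  using basis(3) by (simp add: tail_def)

text \<open>Passing to the derived algebra removes \<open>e 1\<close> and \<open>e 2\<close> at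
  once, hence the offset; each further bracketing with \<open>e 1\<close> shifts the index by
  one.\<close>

lemma lower_central_Suc: "lower_central (Suc k) = tail (k + 3)"
proof (induction k)
  case 0
  have "{bracket x y | x y. y \<in> (UNIV :: 'v set)} \<subseteq> tail 3"
    using bracket_tail[OF UNIV_tail UNIV_tail] by auto
  moreover have "e ` {3..n} \<subseteq> {bracket x y | x y. y \<in> (UNIV :: 'v set)}"
  proof clarify
    fix i assume "i \<in> {3..n}"
    then have "e i = bracket (e 1) (e (i - 1))" using bracket_e1[of "i - 1"] by auto
    then show "\<exists>x y. e i = bracket x y \<and> y \<in> UNIV" by blast
  qed
  ultimately show ?case
    unfolding tail_def lower_central.simps
    by (intro antisym span_minimal span_mono subspace_span) simp_all
next
  case (Suc k)
  have "{bracket x y | x y. y \<in> tail (k + 3)} \<subseteq> tail (k + 4)"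
    using bracket_tail[OF UNIV_tail] by auto
  moreover have "e ` {k + 4..n} \<subseteq> {bracket x y | x y. y \<in> tail (k + 3)}"
  proof clarify
    fix i assume "i \<in> {k + 4..n}"
    then have "e i = bracket (e 1) (e (i - 1))" "e (i - 1) \<in> tail (k + 3)"
      using bracket_e1[of "i - 1"] e_in_tail[of "k + 3" "i - 1"] by auto
    then show "\<exists>x y. e i = bracket x y \<and> y \<in> tail (k + 3)" by blast
  qed
  ultimately have "span {bracket x y | x y. y \<in> tail (k + 3)} = tail (k + 4)"
    unfolding tail_def[of "k + 4"]
    by (intro antisym span_minimal span_mono subspace_span) simp_all
  then show ?case
    using Suc by (simp add: eval_nat_numeral)
qed

lemma e_eq_iff: "1 \<le> i \<Longrightarrow> i \<le> n \<Longrightarrow> 1 \<le> j \<Longrightarrow> j \<le> n \<Longrightarrow> e i = e j \<longleftrightarrow> i = j"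
  by (rule inj_on_eq_iff[OF basis(1)]) auto

lemma e_independent:
  assumes "1 \<le> i" "i < k" "i \<le> n"
  shows "e i \<notin> tail k"
proof -
  have "e ` {k..n} \<subseteq> e ` {1..n} - {e i}"
    using assms e_eq_iff by auto
  then have "tail k \<subseteq> span (e ` {1..n} - {e i})"
    unfolding tail_def by (rule span_mono)
  then show ?thesis
    using basis(2) assms unfolding dependent_def by auto
qed

text \<open>Supplies the filiform property, later for the deformed algebra: the tails beyond
  \<open>n\<close> are zero, and \<open>e 1\<close> takes \<open>e 2\<close> to \<open>e n\<close>
  in \<open>n - 2\<close> steps.\<close>

lemma vergne_type: "vergne_type"
proof -
  have "lower_central (Suc n) = {0}"
    unfolding lower_central_Suc tail_def by simp
  then have "nilpotent"
    unfolding nilpotent_def by blast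
  moreover have "\<exists>S. finite S \<and> span S = UNIV"
    using basis(3) by blast
  moreover have "(bracket (e 1) ^^ (n - 2)) \<noteq> (\<lambda>_. 0)"
  proof -
    have "(bracket (e 1) ^^ m) (e 2) = e (m + 2)" if "m + 2 \<le> n" for m
      using that
    proof (induction m)
      case 0
      show ?case by (simp add: numeral_2_eq_2)
    next
      case (Suc m)
      then show ?case using bracket_e1[of "m + 2"] by simp
    qed
    from this[of "n - 2"] have "(bracket (e 1) ^^ (n - 2)) (e 2) = e n"
      using n_ge le_add_diff_inverse2[of 2 n] by simp
    moreover have "e n \<noteq> 0"
      using e_independent[of n "Suc n"] n_ge by (auto simp: tail_def)
    ultimately show ?thesis by auto
  qed
  ultimately have "filiform"
    unfolding filiform_def n_def by blast
  then show ?thesis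
    unfolding vergne_type_def using vergne by blast
qed

definition coordinate :: "nat \<Rightarrow> 'v \<Rightarrow> 'f" where
  "coordinate i x = representation (e ` {1..n}) x (e i)"

lemma coordinate_add: "coordinate i (x + y) = coordinate i x + coordinate i y"
  using basis by (simp add: coordinate_def representation_add)

lemma coordinate_scale: "coordinate i (scale c x) = c * coordinate i x"
  using basis by (simp add: coordinate_def representation_scale)

lemma coordinate_e:
  assumes "1 \<le> i" "i \<le> n" "1 \<le> j" "j \<le> n"
  shows "coordinate i (e j) = (if i = j then 1 else 0)"
  using assms representation_basis[OF basis(2), of "e j"] e_eq_iff[of i j] e_eq_iff[of j i]
  by (auto simp: coordinate_def)

lemma coordinate_tail:
  assumes "x \<in> tail k" "1 \<le> i" "i < k"
  shows "coordinate i x = 0"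
  using assms(1) unfolding tail_def
proof (induction rule: span_induct_alt)
  case base
  show ?case using coordinate_scale[of i 0 0] by simp
next
  case (step c b z)
  then show ?case
    using assms(2,3) by (auto simp: coordinate_add coordinate_scale coordinate_e)
qed

text \<open>Write \<open>c\<close> for the constant. Modulo \<open>tail 6\<close>, an element
  \<open>scale p (e 1) + scale q (e 2) + r\<close> with \<open>r\<close> in \<open>tail 3\<close>
  sends \<open>e 3\<close> to \<open>scale p (e 4) + scale (q * c) (e 5)\<close>. Outside
  \<open>tail 3\<close> this vanishes only if \<open>p = 0\<close>, \<open>q \<noteq> 0\<close> and
  \<open>c = 0\<close>; conversely \<open>e 2\<close> is a witness.\<close>

lemma structure_constant_2_3_eq_0_iff:
  "structure_constant 2 3 = 0 \<longleftrightarrow>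
    (\<exists>x. x \<notin> lower_central 1 \<and> (\<forall>y\<in>lower_central 1. bracket x y \<in> lower_central 4))"
proof -
  let ?c = "structure_constant 2 3"
  have lc: "lower_central 1 = tail 3" "lower_central 4 = tail 6"
    using lower_central_Suc[of 0] lower_central_Suc[of 3] by (simp_all add: eval_nat_numeral)
  have e23: "bracket (e 2) (e 3) = scale ?c (e 5)"
    using bracket_structure_constant[of 2 3] n_ge by simp
  show ?thesis
    unfolding lc
  proof
    assume c: "?c = 0"
    have "bracket (e 2) y \<in> tail 6" if "y \<in> tail 3" for y
      unfolding tail_def
    proof (rule bracket_span[OF _ that[unfolded tail_def]])
      show "e 2 \<in> span {e 2}" by (simp add: span_base)
      fix a b assume "a \<in> {e 2}" "b \<in> e ` {3..n}"
      then obtain j where j: "a = e 2" "b = e j" "3 \<le> j" "j \<le> n" by auto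
      show "bracket a b \<in> span (e ` {6..n})"
      \<comment> \<open>Only \<open>j = 3\<close> involves the constant; from \<open>j = 4\<close>
        on the index \<open>2 + j\<close> is at least 6.\<close>
      proof (cases "j = 3")
        case True
        then show ?thesis using j e23 c by (simp add: span_zero)
      next
        case False
        then have "bracket a b \<in> tail (max 3 (2 + j))"
          using j n_ge bracket_basis[of 2 j] by simp
        then show ?thesis
          using tail_mono[of 6 "max 3 (2 + j)"] j False by (auto simp: tail_def)
      qed
    qed
    moreover have "e 2 \<notin> tail 3"
      using e_independent[of 2 3] n_ge by simp
    ultimately show "\<exists>x. x \<notin> tail 3 \<and> (\<forall>y\<in>tail 3. bracket x y \<in> tail 6)"
      by blast
  next
    assume "\<exists>x. x \<notin> tail 3 \<and> (\<forall>y\<in>tail 3. bracket x y \<in> tail 6)"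
    then obtain x where x: "x \<notin> tail 3" "\<And>y. y \<in> tail 3 \<Longrightarrow> bracket x y \<in> tail 6" by blast
    have "{1..n} = insert 1 (insert 2 {3..n})" using n_ge by auto
    then have "x \<in> span (insert (e 1) (insert (e 2) (e ` {3..n})))"
      using basis(3) by simp
    then obtain p q where r: "x - scale p (e 1) - scale q (e 2) \<in> tail 3"
      unfolding span_breakdown_eq tail_def by blast
    define r where "r = x - scale p (e 1) - scale q (e 2)"
    have x_eq: "x = scale p (e 1) + scale q (e 2) + r" by (simp add: r_def)
    have e3: "e 3 \<in> tail 3" using e_in_tail n_ge by simp
    have r6: "bracket r (e 3) \<in> tail 6"
      using bracket_tail[OF r e3, of 6] by (simp add: r_def)
    have xe3: "bracket x (e 3) = scale p (e 4) + scale (q * ?c) (e 5) + bracket r (e 3)"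
      using bracket_e1[of 3] n_ge by (simp add: x_eq bracket_add_left bracket_scale_left e23)
    have "coordinate 4 (bracket x (e 3)) = p" "coordinate 5 (bracket x (e 3)) = q * ?c"
      unfolding xe3 using n_ge r6
      by (simp_all add: coordinate_add coordinate_scale coordinate_e coordinate_tail)
    moreover have "coordinate 4 (bracket x (e 3)) = 0" "coordinate 5 (bracket x (e 3)) = 0"
      using x(2)[OF e3] by (simp_all add: coordinate_tail)
    ultimately have "p = 0" "q * ?c = 0" by simp_all
    \<comment> \<open>If the constant were nonzero, \<open>q\<close> would vanish too and
      \<open>x\<close> would equal \<open>r\<close>, an element of \<open>tail 3\<close>.\<close>
    then show "?c = 0"
      using x(1) r by auto
  qed
qed

end

text \<open>The criterion for the constant mentions only the bracket and the lower central series,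
  so under an isomorphism the two constants would vanish together.\<close>

lemma not_lie_isomorphic:
  assumes "vergne_algebra scale bracket e n" "vergne_algebra scale' bracket' e' n'"
    and "vergne_algebra.structure_constant scale bracket e n 2 3 = 0 \<longleftrightarrow>
      vergne_algebra.structure_constant scale' bracket' e' n' 2 3 \<noteq> 0"
  shows "\<not> lie_isomorphic scale bracket scale' bracket'"
proof
  interpret V: vergne_algebra scale bracket e n by fact
  interpret V': vergne_algebra scale' bracket' e' n' by fact
  assume "lie_isomorphic scale bracket scale' bracket'"
  then obtain \<phi> where \<phi>: "Vector_Spaces.linear scale scale' \<phi>" "bij \<phi>"
    "\<And>x y. \<phi> (bracket x y) = bracket' (\<phi> x) (\<phi> y)"
    unfolding lie_isomorphic_def by blast
  have lc: "V'.lower_central k = \<phi> ` V.lower_central k" for k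
    by (rule lie_isomorphic_lower_central[symmetric])
      (fact V.lie_algebra_axioms V'.lie_algebra_axioms \<phi>)+
  have inj: "\<phi> x \<in> \<phi> ` A \<longleftrightarrow> x \<in> A" for x A
    using \<phi>(2) by (simp add: bij_is_inj inj_image_mem_iff)
  have ex: "(\<exists>x. P (\<phi> x)) \<longleftrightarrow> (\<exists>x. P x)" for P
    using \<phi>(2) by (metis bij_pointE)
  have "(\<exists>x. x \<notin> V.lower_central 1 \<and> (\<forall>y\<in>V.lower_central 1. bracket x y \<in> V.lower_central 4)) \<longleftrightarrow>
    (\<exists>x. \<phi> x \<notin> V'.lower_central 1 \<and> (\<forall>y\<in>V'.lower_central 1. bracket' (\<phi> x) y \<in> V'.lower_central 4))"
    unfolding lc ball_simps \<phi>(3)[symmetric] inj ..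
  also have "\<dots> \<longleftrightarrow> (\<exists>x. x \<notin> V'.lower_central 1 \<and>
      (\<forall>y\<in>V'.lower_central 1. bracket' x y \<in> V'.lower_central 4))"
    by (rule ex)
  finally show False
    using assms(3) V.structure_constant_2_3_eq_0_iff V'.structure_constant_2_3_eq_0_iff by blast
qed

section \<open>The deformation of an algebra of Vergne type\<close>

locale char2_vergne_algebra = vergne_algebra scale bracket e n + char2_lie_algebra scale bracket
  for scale :: "'f::field \<Rightarrow> 'v::ab_group_add \<Rightarrow> 'v" and bracket e n +
  fixes t :: 'f
begin

text \<open>The second coordinate vanishes on \<open>e 1\<close> and on all brackets, which lie in
  \<open>tail 3\<close>, so each of its multiples is admissible.\<close>

sublocale char2_deformation scale bracket "\<lambda>x. t * coordinate 2 x" "e 1"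
proof
  show "t * coordinate 2 (bracket x y) = 0" for x y
    using bracket_tail[OF UNIV_tail UNIV_tail, of 3 x y] by (simp add: coordinate_tail)
  show "t * coordinate 2 (e 1) = 0"
    using n_ge by (simp add: coordinate_e)
qed (simp_all add: coordinate_add coordinate_scale algebra_simps)

declare One_nat_def [simp del]

lemma ad_square_e:
  assumes "2 \<le> i" "i \<le> n"
  shows "ad_square (e i) = (if i + 2 \<le> n then e (i + 2) else 0)"
proof -
  have "i + 2 \<le> n \<or> i + 1 = n \<or> i = n"
    using assms by linarith
  then consider "i + 2 \<le> n" | "i + 1 = n" | "i = n"
    by blast
  then show ?thesis
    by cases (use assms bracket_e1[of i] bracket_e1[of "i + 1"] bracket_e1_last in
      \<open>auto simp: ad_square_def add.assoc simp del: add_2_eq_Suc'\<close>)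
qed

lemma deformed_e1: "deformed (e 1) x = bracket (e 1) x"
  using n_ge by (simp add: deformed_def ad_square_def bracket_self coordinate_e)

text \<open>For \<open>i = j = 2\<close> the two copies of \<open>t\<close> cancel, as they must;
  otherwise only constants with exactly one index 2 change.\<close>

lemma deformed_e:
  assumes "2 \<le> i" "i \<le> n" "2 \<le> j" "j \<le> n"
  shows "deformed (e i) (e j) = bracket (e i) (e j) +
    (if i + j \<le> n then scale ((if i = 2 then t else 0) + (if j = 2 then t else 0)) (e (i + j)) else 0)"
  using assms by (auto simp: deformed_def ad_square_e coordinate_e scale_left_distrib add_ac)

sublocale deformed: vergne_algebra scale deformed e n
proof
  have "\<forall>i j. 2 \<le> i \<and> 2 \<le> j \<and> i + j \<le> n \<longrightarrow> deformed (e i) (e j) =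
      scale (structure_constant i j + ((if i = 2 then t else 0) + (if j = 2 then t else 0))) (e (i + j))"
  proof (intro allI impI)
    fix i j assume "2 \<le> i \<and> 2 \<le> j \<and> i + j \<le> n"
    then show "deformed (e i) (e j) =
        scale (structure_constant i j + ((if i = 2 then t else 0) + (if j = 2 then t else 0))) (e (i + j))"
      using deformed_e[of i j] bracket_structure_constant[of i j] by (simp only: scale_left_distrib) simp
  qed
  then have "\<exists>c. \<forall>i j. 2 \<le> i \<and> 2 \<le> j \<and> i + j \<le> n \<longrightarrow>
      deformed (e i) (e j) = scale (c i j) (e (i + j))"
    by (rule exI[of _ "\<lambda>i j. structure_constant i j + ((if i = 2 then t else 0) + (if j = 2 then t else 0))"])
  moreover have "\<forall>i j. 2 \<le> i \<and> i \<le> n \<and> 2 \<le> j \<and> j \<le> n \<and> n < i + j \<longrightarrow> deformed (e i) (e j) = 0"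
    using deformed_e bracket_e_eq_zero by simp
  moreover have "\<forall>i. 2 \<le> i \<and> i < n \<longrightarrow> deformed (e 1) (e i) = e (i + 1)"
    unfolding deformed_e1 using bracket_e1 by blast
  moreover have "deformed (e 1) (e n) = 0"
    unfolding deformed_e1 by (rule bracket_e1_last)
  ultimately show "deformed.vergne_basis e"
    unfolding deformed.vergne_basis_def Let_def n_def[symmetric]
    by (intro conjI basis)
qed (use n_def n_ge in auto)

lemma deformed_structure_constant_2_3:
  "deformed.structure_constant 2 3 = structure_constant 2 3 + t"
proof -
  have "scale (deformed.structure_constant 2 3) (e 5) = scale (structure_constant 2 3 + t) (e 5)"
    using deformed.bracket_structure_constant[of 2 3] deformed_e[of 2 3]
      bracket_structure_constant[of 2 3] n_ge
    by (simp add: scale_left_distrib)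
  moreover have "e 5 \<noteq> 0"
    using e_independent[of 5 6] n_ge by (auto simp: tail_def span_zero)
  ultimately show ?thesis by simp
qed

end

theorem theorem2:
  fixes scale :: "'f::field \<Rightarrow> 'v::ab_group_add \<Rightarrow> 'v"
    and bracket :: "'v \<Rightarrow> 'v \<Rightarrow> 'v"
  assumes "CHAR('f) = 2"
    and "lie_algebra scale bracket"
    and "lie_algebra.vergne_type scale bracket"
    and "vector_space.dim scale (UNIV :: 'v set) \<ge> 5"
  shows "\<exists>(scale' :: 'f \<Rightarrow> 'v \<Rightarrow> 'v) bracket'.
    lie_algebra scale' bracket' \<and>
    lie_algebra.vergne_type scale' bracket' \<and>
    \<not> lie_isomorphic scale bracket scale' bracket' \<and>
    (\<forall>k. lie_algebra.betti scale' bracket' k = lie_algebra.betti scale bracket k)"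
proof -
  interpret L: lie_algebra scale bracket by fact
  obtain e where "L.vergne_basis e"
    using assms(3) by (auto simp: L.vergne_type_def)
  then interpret V: vergne_algebra scale bracket e "L.dim UNIV"
    using assms(4) by unfold_locales auto
  let ?c = "V.structure_constant 2 3"
  \<comment> \<open>The scalar 1 turns a zero constant into 1, and the scalar \<open>?c\<close>
    turns a nonzero one into \<open>?c + ?c = 0\<close>; either way exactly one of the two constants
    vanishes.\<close>
  interpret C: char2_vergne_algebra scale bracket e "L.dim UNIV" "if ?c = 0 then 1 else ?c"
    using assms(1) by unfold_locales
  have "\<not> lie_isomorphic scale bracket scale C.deformed"
    by (rule not_lie_isomorphic[OF V.vergne_algebra_axioms C.deformed.vergne_algebra_axioms])
      (simp add: C.deformed_structure_constant_2_3)
  then show ?thesis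
    using C.deformed.lie_algebra_axioms C.deformed.vergne_type C.betti_deformed by blast
qed

end
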